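(* Let $n\ge 2$, let $\Gamma$ be a non-elementary purely loxodromic Kleinian group acting on $\mathbb{H}^n$, and let $\Phi$ and $\Theta$ be non-trivial subgroups of $\Gamma$. Then $$\Lambda_c(\Phi)\cap\Lambda_c^u(\Theta)\subseteq\Lambda_c(\Phi\cap\Theta).$$
   Context: $\mathbb{H}^n$ is real hyperbolic $n$-space with sphere at infinity $\mathbb{S}^{n-1}_\infty$. A Kleinian group acting on $\mathbb{H}^n$ is a discrete subgroup of the group $\mathrm{Isom}^+(\mathbb{H}^n)$ of orientation-preserving isometries of $\mathbb{H}^n$. It is purely loxodromic if it contains no parabolic or elliptic elements, i.e. every non-trivial element is loxodromic. It is non-elementary if it is not virtually abelian. The limit set $\Lambda(G)\subseteq\mathbb{S}^{n-1}_\infty$ of a purely loxodromic Kleinian group $G$ is the closure in $\mathbb{S}^{n-1}_\infty$ of the set of fixed points of loxodromic elements of $G$ (so it is empty if $G$ is trivial). A point $x\in\Lambda(G)$ is a conical limit point of $G$ if for every geodesic ray $r\subset\mathbb{H}^n$ with $x$ as its endpoint at infinity there exist a compact set $K\subset\mathbb{H}^n$ and a sequence $\{\gamma_k\}$ of distinct elements of $G$ such that $\gamma_k(K)\cap r$ is non-empty for all $k$. The set of conical limit points of $G$ is denoted $\Lambda_c(G)$. A point $x\in\Lambda(G)$ is a uniform conical limit point of $G$ if for every geodesic ray $r\subset\mathbb{H}^n$ with $x$ as its endpoint at infinity there exist a compact set $K\subset\mathbb{H}^n$ and a sequence $\{\gamma_k\}$ of distinct elements of $G$ such that $r\subset\bigcup_k\gamma_k(K)$.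 The set of uniform conical limit points of $G$ is denoted $\Lambda_c^u(G)$. *)

theory Defs
  imports "HOL-Analysis.Analysis" "HOL-Algebra.Bij" "HOL-Algebra.Coset"
begin

text \<open>
  Hyperbolic \<open>n\<close>-space is the Poincare ball model: the open unit ball of \<open>real ^ 'n\<close> with
  \<open>n = CARD('n)\<close>, carrying the metric \<open>hdist\<close> of constant curvature \<open>-1\<close>; its sphere at
  infinity is the Euclidean unit sphere. On the ball, \<open>hdist\<close> induces the Euclidean topology,
  so Euclidean compactness of a subset is compactness in hyperbolic space.
\<close>

abbreviation hyperbolic_space :: "(real ^ 'n) set"
  where "hyperbolic_space \<equiv> ball 0 1"

abbreviation sphere_at_infinity :: "(real ^ 'n) set"
  where "sphere_at_infinity \<equiv> sphere 0 1"

definition hdist :: "real ^ 'n \<Rightarrow> real ^ 'n \<Rightarrow> real"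
  where "hdist x y =
    arcosh (1 + 2 * (norm (x - y))\<^sup>2 / ((1 - (norm x)\<^sup>2) * (1 - (norm y)\<^sup>2)))"

definition orientation_preserving :: "(real ^ 'n \<Rightarrow> real ^ 'n) \<Rightarrow> bool"
  where "orientation_preserving f \<longleftrightarrow>
    (\<forall>x\<in>hyperbolic_space. \<exists>f'. (f has_derivative f') (at x) \<and> det (matrix f') > 0)"

text \<open>
  Self-maps of hyperbolic space are represented, as in \<^const>\<open>BijGroup\<close>, by extensional
  functions (constantly \<open>undefined\<close> outside the ball), so that the representation is unique.
\<close>

definition isom_plus :: "(real ^ 'n \<Rightarrow> real ^ 'n) set"
  where "isom_plus = {f \<in> Bij hyperbolic_space.
    (\<forall>x\<in>hyperbolic_space. \<forall>y\<in>hyperbolic_space. hdist (f x) (f y) = hdist x y) \<and>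
    orientation_preserving f}"

abbreviation hyp_group :: "(real ^ 'n \<Rightarrow> real ^ 'n) set \<Rightarrow> (real ^ 'n \<Rightarrow> real ^ 'n) monoid"
  where "hyp_group G \<equiv> (BijGroup hyperbolic_space)\<lparr>carrier := G\<rparr>"

text \<open>
  Discreteness refers to the product topology on functions. As the values outside the ball are
  fixed, this is the topology of pointwise convergence on hyperbolic space, which for groups of
  isometries is the compact-open topology.
\<close>

definition kleinian_group :: "(real ^ 'n \<Rightarrow> real ^ 'n) set \<Rightarrow> bool"
  where "kleinian_group G \<longleftrightarrow>
    subgroup G (BijGroup hyperbolic_space) \<and> G \<subseteq> isom_plus \<and> discrete G"

text \<open>
  An isometry extends continuously to the closed ball; the extension fixes the point \<open>x\<close> at
  infinity iff the isometry tends to \<open>x\<close> at \<open>x\<close> from within the ball.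
\<close>

definition fixes_at_infinity :: "(real ^ 'n \<Rightarrow> real ^ 'n) \<Rightarrow> real ^ 'n \<Rightarrow> bool"
  where "fixes_at_infinity g x \<longleftrightarrow>
    x \<in> sphere_at_infinity \<and> (g \<longlongrightarrow> x) (at x within hyperbolic_space)"

definition loxodromic :: "(real ^ 'n \<Rightarrow> real ^ 'n) \<Rightarrow> bool"
  where "loxodromic g \<longleftrightarrow>
    (\<forall>x\<in>hyperbolic_space. g x \<noteq> x) \<and> card {x. fixes_at_infinity g x} = 2"

definition purely_loxodromic :: "(real ^ 'n \<Rightarrow> real ^ 'n) set \<Rightarrow> bool"
  where "purely_loxodromic G \<longleftrightarrow>
    (\<forall>g\<in>G. g \<noteq> \<one>\<^bsub>BijGroup hyperbolic_space\<^esub> \<longrightarrow> loxodromic g)"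

definition virtually_abelian :: "('a, 'b) monoid_scheme \<Rightarrow> bool"
  where "virtually_abelian G \<longleftrightarrow>
    (\<exists>H. subgroup H G \<and> comm_group (G\<lparr>carrier := H\<rparr>) \<and> finite (rcosets\<^bsub>G\<^esub> H))"

definition non_elementary :: "(real ^ 'n \<Rightarrow> real ^ 'n) set \<Rightarrow> bool"
  where "non_elementary G \<longleftrightarrow> \<not> virtually_abelian (hyp_group G)"

text \<open>
  The sphere at infinity is closed, so the Euclidean closure is the closure in that sphere.
\<close>

definition limit_set :: "(real ^ 'n \<Rightarrow> real ^ 'n) set \<Rightarrow> (real ^ 'n) set"
  where "limit_set G = closure {x. \<exists>g\<in>G. loxodromic g \<and> fixes_at_infinity g x}"

definition geodesic_ray_to :: "(real ^ 'n) set \<Rightarrow> real ^ 'n \<Rightarrow> bool"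
  where "geodesic_ray_to r x \<longleftrightarrow>
    (\<exists>c. r = c ` {0..} \<and> r \<subseteq> hyperbolic_space \<and>
      (\<forall>s\<ge>0. \<forall>t\<ge>0. hdist (c s) (c t) = \<bar>s - t\<bar>) \<and> (c \<longlongrightarrow> x) at_top)"

definition conical_limit_set :: "(real ^ 'n \<Rightarrow> real ^ 'n) set \<Rightarrow> (real ^ 'n) set"
  where "conical_limit_set G = {x \<in> limit_set G. \<forall>r. geodesic_ray_to r x \<longrightarrow>
    (\<exists>K (\<gamma> :: nat \<Rightarrow> real ^ 'n \<Rightarrow> real ^ 'n).
      compact K \<and> K \<subseteq> hyperbolic_space \<and> inj \<gamma> \<and> range \<gamma> \<subseteq> G \<and>
      (\<forall>k. \<gamma> k ` K \<inter> r \<noteq> {}))}"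

definition uniform_conical_limit_set :: "(real ^ 'n \<Rightarrow> real ^ 'n) set \<Rightarrow> (real ^ 'n) set"
  where "uniform_conical_limit_set G = {x \<in> limit_set G. \<forall>r. geodesic_ray_to r x \<longrightarrow>
    (\<exists>K (\<gamma> :: nat \<Rightarrow> real ^ 'n \<Rightarrow> real ^ 'n).
      compact K \<and> K \<subseteq> hyperbolic_space \<and> inj \<gamma> \<and> range \<gamma> \<subseteq> G \<and>
      r \<subseteq> (\<Union>k. \<gamma> k ` K))}"

end

theory Submission
  imports Defs
begin

text \<open>
  Let \<open>x\<close> be a conical limit point of \<open>\<Phi>\<close> and a uniform conical limit point of \<open>\<Theta>\<close>, and let \<open>r\<close> be a
  ray ending at \<open>x\<close>. Infinitely many translates \<open>\<phi>\<^sub>k K\<close> meet \<open>r\<close>, and each meeting point is also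
  covered by some translate \<open>\<theta>\<^sub>j L\<close>. So \<open>\<phi>\<^sub>k\<inverse> \<theta>\<^sub>j\<close> moves a point of the compact set \<open>L\<close> into the
  compact set \<open>K\<close>, and by proper discontinuity of \<open>\<Gamma>\<close>
  (\<open>kleinian_group_properly_discontinuous\<close>) it takes a single value for infinitely many \<open>k\<close>.
  Comparing two such indices shows that \<open>\<phi>\<^sub>k \<phi>\<^bsub>k0\<^esub>\<inverse>\<close> lies in \<open>\<Phi> \<inter> \<Theta>\<close>. These distinct elements
  translate the compact set \<open>\<phi>\<^bsub>k0\<^esub> K\<close> to sets that meet \<open>r\<close> (\<open>conical_sequence_inter\<close>).

  It remains to see that \<open>x\<close> lies in the limit set of \<open>\<Phi> \<inter> \<Theta>\<close>, which is defined by loxodromic fixed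
  points. Applied to the radial ray, the first part gives infinitely many \<open>\<psi>\<^sub>k \<in> \<Phi> \<inter> \<Theta>\<close> whose orbit
  points \<open>\<psi>\<^sub>k 0\<close> come arbitrarily close to \<open>x\<close> (\<open>conical_sequence_limit\<close>). A nontrivial element \<open>h\<close>
  of \<open>\<Phi> \<inter> \<Theta>\<close> is loxodromic with two fixed points \<open>p \<noteq> q\<close>, and its conjugate by \<open>\<psi>\<^sub>k\<close> fixes the
  boundary values \<open>\<psi>\<^sub>k p\<close> and \<open>\<psi>\<^sub>k q\<close>. One of these is within \<open>2 (1 - \<bar>\<psi>\<^sub>k 0\<bar>\<^sup>2) / \<bar>p - q\<bar>\<close> of
  \<open>\<psi>\<^sub>k 0\<close>, so \<open>x\<close> is a limit of fixed points (\<open>orbit_accumulation_in_limit_set\<close>).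

  All facts about isometries come from one identity: if \<open>g b = 0\<close>, then
  \<open>\<bar>g x - g y\<bar>\<^sup>2 = \<bar>x - y\<bar>\<^sup>2 (1 - \<bar>b\<bar>\<^sup>2)\<^sup>2 / (D x D y)\<close> with \<open>D x = 1 - 2 b \<bullet> x + \<bar>b\<bar>\<^sup>2 \<bar>x\<bar>\<^sup>2\<close>
  (\<open>ball_isometry_norm_diff\<close>). It makes \<open>g\<close> Lipschitz in the Euclidean metric, extends it to the
  sphere (\<open>ball_isometry_boundary\<close>) and gives the estimate above.
\<close>

section \<open>Isometries of the ball model\<close>

text \<open>
  The hyperbolic distance \<open>d\<close> enters only through \<open>(sinh (d / 2))\<^sup>2\<close>: this is an algebraic function of
  the points and determines \<open>d\<close>.
\<close>

definition sinh_sq_half :: "'a::real_inner \<Rightarrow> 'a \<Rightarrow> real"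
  where "sinh_sq_half x y = (norm (x - y))\<^sup>2 / ((1 - (norm x)\<^sup>2) * (1 - (norm y)\<^sup>2))"

lemma one_minus_norm_sq_pos: "norm x < 1 \<Longrightarrow> 1 - (norm x)\<^sup>2 > 0"
  by (simp add: power_less_one_iff abs_square_less_1)

lemma sinh_sq_half_nonneg: "norm x < 1 \<Longrightarrow> norm y < 1 \<Longrightarrow> sinh_sq_half x y \<ge> 0"
  unfolding sinh_sq_half_def
  by (intro divide_nonneg_nonneg mult_nonneg_nonneg) (auto dest: one_minus_norm_sq_pos less_imp_le)

lemma hdist_eq: "hdist x y = arcosh (1 + 2 * sinh_sq_half x y)"
  by (simp add: hdist_def sinh_sq_half_def)

lemma cosh_hdist:
  assumes "norm x < 1" "norm y < 1"
  shows "cosh (hdist x y) = 1 + 2 * sinh_sq_half x y"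
  using sinh_sq_half_nonneg[OF assms] by (simp add: hdist_eq)

lemma norm_diff_sq_eq:
  assumes "norm x < 1" "norm y < 1"
  shows "(norm (x - y))\<^sup>2 = sinh_sq_half x y * ((1 - (norm x)\<^sup>2) * (1 - (norm y)\<^sup>2))"
  using assms[THEN one_minus_norm_sq_pos] by (simp add: sinh_sq_half_def)

definition ball_isometry :: "('a::real_inner \<Rightarrow> 'a) \<Rightarrow> bool"
  where "ball_isometry g \<longleftrightarrow> bij_betw g (ball 0 1) (ball 0 1) \<and>
    (\<forall>x\<in>ball 0 1. \<forall>y\<in>ball 0 1. sinh_sq_half (g x) (g y) = sinh_sq_half x y)"

lemma isom_plus_ball_isometry:
  assumes "g \<in> isom_plus"
  shows "ball_isometry g"
proof -
  have bij: "bij_betw g (ball 0 1) (ball 0 1)"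
    using assms by (simp add: isom_plus_def Bij_def)
  moreover have "sinh_sq_half (g x) (g y) = sinh_sq_half x y"
    if "x \<in> ball 0 1" "y \<in> ball 0 1" for x y
  proof -
    have "g x \<in> ball 0 1" "g y \<in> ball 0 1"
      using bij that by (auto dest: bij_betwE)
    moreover have "hdist (g x) (g y) = hdist x y"
      using assms that by (simp add: isom_plus_def)
    ultimately show ?thesis
      using cosh_hdist[of x y] cosh_hdist[of "g x" "g y"] that by simp
  qed
  ultimately show ?thesis
    by (simp add: ball_isometry_def)
qed

text \<open>
  For an isometry \<open>g\<close> of the ball with \<open>g b = 0\<close>, the local Euclidean scaling factor at \<open>x\<close> is
  \<open>(1 - \<bar>b\<bar>\<^sup>2) / conformal_denom b x\<close>; equivalently the denominator is
  \<open>\<bar>b\<bar>\<^sup>2 \<bar>x - b*\<bar>\<^sup>2\<close>, where \<open>b* = b / \<bar>b\<bar>\<^sup>2\<close> is the inversion of \<open>b\<close> in the unit sphere,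
  when \<open>b \<noteq> 0\<close>.
\<close>

definition conformal_denom :: "'a::real_inner \<Rightarrow> 'a \<Rightarrow> real"
  where "conformal_denom b x = 1 - 2 * (b \<bullet> x) + (norm b)\<^sup>2 * (norm x)\<^sup>2"

lemma conformal_denom_alt:
  "conformal_denom b x = (norm (x - b))\<^sup>2 + (1 - (norm x)\<^sup>2) * (1 - (norm b)\<^sup>2)"
  by (simp add: conformal_denom_def power2_norm_eq_inner inner_diff algebra_simps inner_commute)

lemma conformal_denom_ge: "conformal_denom b x \<ge> (1 - norm b * norm x)\<^sup>2"
  using norm_cauchy_schwarz[of b x]
  by (simp add: conformal_denom_def power2_eq_square algebra_simps)

lemma conformal_denom_pos:
  assumes "norm b < 1" "norm x \<le> 1"
  shows "conformal_denom b x > 0"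
proof -
  have "norm b * norm x < 1"
    using assms by (smt (verit) mult_left_le norm_ge_zero)
  then have "(1 - norm b * norm x)\<^sup>2 > 0"
    by simp
  then show ?thesis
    using conformal_denom_ge[of b x] by linarith
qed

lemma conformal_denom_sphere: "norm p = 1 \<Longrightarrow> conformal_denom b p = (norm (p - b))\<^sup>2"
  by (simp add: conformal_denom_alt)

lemma conformal_denom_zero [simp]: "conformal_denom b 0 = 1"
  by (simp add: conformal_denom_def)

lemma ball_isometry_norm_less: "ball_isometry g \<Longrightarrow> norm x < 1 \<Longrightarrow> norm (g x) < 1"
  unfolding ball_isometry_def using bij_betwE by fastforce

lemma ball_isometry_preserves:
  "ball_isometry g \<Longrightarrow> norm x < 1 \<Longrightarrow> norm y < 1 \<Longrightarrow> sinh_sq_half (g x) (g y) = sinh_sq_half x y"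
  by (simp add: ball_isometry_def)

text \<open>
  Invariance of the distance from \<open>x\<close> to \<open>b\<close>, whose image is the origin, determines \<open>\<bar>g x\<bar>\<close>.
\<close>

lemma ball_isometry_one_minus_norm_sq:
  assumes g: "ball_isometry g" and b: "norm b < 1" "g b = 0" and x: "norm x < 1"
  shows "1 - (norm (g x))\<^sup>2 = (1 - (norm x)\<^sup>2) * (1 - (norm b)\<^sup>2) / conformal_denom b x"
proof -
  define u v w where "u = 1 - (norm (g x))\<^sup>2" and "v = 1 - (norm x)\<^sup>2" and "w = 1 - (norm b)\<^sup>2"
  have pos: "u > 0" "v > 0" "w > 0"
    using one_minus_norm_sq_pos ball_isometry_norm_less[OF g x] x b by (auto simp: u_def v_def w_def)
  have "sinh_sq_half (g x) (g b) = sinh_sq_half x b"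
    by (rule ball_isometry_preserves[OF g x b(1)])
  then have "(1 - u) / u = (norm (x - b))\<^sup>2 / (v * w)"
    by (simp add: sinh_sq_half_def b u_def v_def w_def)
  then have "(1 - u) * (v * w) = (norm (x - b))\<^sup>2 * u"
    using pos by (simp add: frac_eq_eq)
  then have "u * conformal_denom b x = v * w"
    by (simp add: conformal_denom_alt flip: v_def w_def) (simp add: algebra_simps)
  then show ?thesis
    using conformal_denom_pos[of b x] x b by (simp add: eq_divide_eq flip: u_def v_def w_def)
qed

text \<open>
  The Euclidean distortion of an isometry is explicit once the point sent to the origin is known.
  This identity replaces the classification of the isometries as Moebius maps: the denominators
  stay away from \<open>0\<close> on the closed ball, which yields the Lipschitz bound, the extension to the
  sphere, and the estimates near the sphere used for limit points.
\<close>

lemma ball_isometry_norm_diff: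
  assumes g: "ball_isometry g" and b: "norm b < 1" "g b = 0" and x: "norm x < 1" and y: "norm y < 1"
  shows "(norm (g x - g y))\<^sup>2 =
    (norm (x - y))\<^sup>2 * (1 - (norm b)\<^sup>2)\<^sup>2 / (conformal_denom b x * conformal_denom b y)"
proof -
  have "(norm (g x - g y))\<^sup>2 = sinh_sq_half x y * ((1 - (norm (g x))\<^sup>2) * (1 - (norm (g y))\<^sup>2))"
    using norm_diff_sq_eq[of "g x" "g y"] ball_isometry_norm_less[OF g] x y
    by (simp add: ball_isometry_preserves[OF g])
  then show ?thesis
    by (simp add: ball_isometry_one_minus_norm_sq[OF g b x] ball_isometry_one_minus_norm_sq[OF g b y]
        norm_diff_sq_eq[OF x y] power2_eq_square[of "1 - (norm b)\<^sup>2"])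
qed

text \<open>
  \<open>g\<inverse> 0\<close> and \<open>g 0\<close> are equally far from the origin, so estimates in terms of the former become
  estimates in terms of the orbit point.
\<close>

lemma ball_isometry_obtain_zero:
  assumes "ball_isometry g"
  obtains b where "norm b < 1" "g b = 0" "norm b = norm (g 0)"
proof -
  have "0 \<in> g ` ball 0 1"
    using assms by (simp add: ball_isometry_def bij_betw_def)
  then obtain b where b: "norm b < 1" "g b = 0"
    by auto
  have "(norm (g 0))\<^sup>2 = (norm b)\<^sup>2"
    using ball_isometry_one_minus_norm_sq[OF assms b, of 0] by simp
  then have "norm b = norm (g 0)"
    by simp
  with b that show thesis by blast
qed

lemma ball_isometry_lipschitz:
  assumes g: "ball_isometry g"
  obtains L where "L \<ge> 0" "\<And>x y. norm x < 1 \<Longrightarrow> norm y < 1 \<Longrightarrow> norm (g x - g y) \<le> L * norm (x - y)"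
proof -
  obtain b where b: "norm b < 1" "g b = 0"
    using ball_isometry_obtain_zero[OF g] by blast
  define m where "m = 1 - norm b"
  have m: "m > 0" using b by (simp add: m_def)
  have D: "conformal_denom b x \<ge> m\<^sup>2" if "norm x < 1" for x
  proof -
    have "m \<le> 1 - norm b * norm x"
      using that by (simp add: m_def mult_left_le)
    then have "m\<^sup>2 \<le> (1 - norm b * norm x)\<^sup>2"
      using m by (intro power_mono) auto
    then show ?thesis
      using conformal_denom_ge[of b x] by linarith
  qed
  have "norm (g x - g y) \<le> (1 / m\<^sup>2) * norm (x - y)" if x: "norm x < 1" and y: "norm y < 1" for x y
  proof (rule power2_le_imp_le)
    have "(norm (g x - g y))\<^sup>2 \<le> (norm (x - y))\<^sup>2 * 1 / (m\<^sup>2 * m\<^sup>2)"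
      unfolding ball_isometry_norm_diff[OF g b x y]
    proof (intro frac_le mult_left_mono)
      show "m\<^sup>2 * m\<^sup>2 \<le> conformal_denom b x * conformal_denom b y"
        using D[OF x] D[OF y] order_trans[OF zero_le_power2 D[OF x]] by (intro mult_mono) simp_all
      show "(1 - (norm b)\<^sup>2)\<^sup>2 \<le> 1"
        using one_minus_norm_sq_pos[OF b(1)] by (intro power_le_one) auto
    qed (use m in auto)
    then show "(norm (g x - g y))\<^sup>2 \<le> ((1 / m\<^sup>2) * norm (x - y))\<^sup>2"
      by (simp add: power_mult_distrib power_divide power2_eq_square)
  qed (use m in auto)
  then show thesis
    using that[of "1 / m\<^sup>2"] by simp
qed

lemma ball_isometry_uniformly_continuous:
  assumes "ball_isometry g"
  shows "uniformly_continuous_on (ball 0 1) g"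
proof -
  obtain L where L: "L \<ge> 0" "\<And>x y. norm x < 1 \<Longrightarrow> norm y < 1 \<Longrightarrow> norm (g x - g y) \<le> L * norm (x - y)"
    using ball_isometry_lipschitz[OF assms] by blast
  then have "L-lipschitz_on (ball 0 1) g"
    by (auto intro!: lipschitz_onI simp: dist_norm)
  then show ?thesis
    by (rule lipschitz_on_uniformly_continuous)
qed

lemma at_sphere_within_ball_neq_bot:
  fixes p :: "'a::euclidean_space"
  assumes "norm p = 1"
  shows "at p within ball 0 1 \<noteq> bot"
  using assms by (simp add: trivial_limit_within islimpt_ball)

text \<open>
  By uniform continuity the limit \<open>p'\<close> exists in the closed ball; passing to the limit in the two
  identities above, with \<open>y = 0\<close> in the second, shows that it lies on the sphere and gives its
  distance from \<open>g 0\<close>. That distance is small when \<open>g 0\<close> is close to the sphere, unless \<open>p\<close> is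
  close to \<open>b\<close>.
\<close>

lemma ball_isometry_boundary:
  fixes g :: "'a::euclidean_space \<Rightarrow> 'a"
  assumes g: "ball_isometry g" and b: "norm b < 1" "g b = 0" and p: "norm p = 1"
  obtains p' where "norm p' = 1" "(g \<longlongrightarrow> p') (at p within ball 0 1)"
    "norm (p' - g 0) * norm (p - b) = 1 - (norm b)\<^sup>2"
proof -
  let ?F = "at p within ball 0 1"
  have "p \<in> closure (ball 0 1)"
    using p by simp
  then obtain p' where lim: "(g \<longlongrightarrow> p') ?F"
    using uniformly_continuous_on_extension_at_closure[OF ball_isometry_uniformly_continuous[OF g]] by blast
  have inb: "\<forall>\<^sub>F x in ?F. norm x < 1"
    by (auto simp: eventually_at_filter)
  have Dp: "conformal_denom b p > 0"
    using conformal_denom_pos[of b p] p b by simp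
  have Dlim: "((\<lambda>x. conformal_denom b x) \<longlongrightarrow> conformal_denom b p) ?F"
    unfolding conformal_denom_def by (intro tendsto_intros)
  have "((\<lambda>x. (1 - (norm x)\<^sup>2) * (1 - (norm b)\<^sup>2) / conformal_denom b x) \<longlongrightarrow>
      (1 - (norm p)\<^sup>2) * (1 - (norm b)\<^sup>2) / conformal_denom b p) ?F"
    using Dp by (intro tendsto_intros Dlim) auto
  moreover have "\<forall>\<^sub>F x in ?F. (1 - (norm x)\<^sup>2) * (1 - (norm b)\<^sup>2) / conformal_denom b x = 1 - (norm (g x))\<^sup>2"
    by (rule eventually_mono[OF inb]) (simp add: ball_isometry_one_minus_norm_sq[OF g b])
  ultimately have "((\<lambda>x. 1 - (norm (g x))\<^sup>2) \<longlongrightarrow> (1 - (norm p)\<^sup>2) * (1 - (norm b)\<^sup>2) / conformal_denom b p) ?F"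
    by (rule Lim_transform_eventually)
  then have "((\<lambda>x. 1 - (norm (g x))\<^sup>2) \<longlongrightarrow> 0) ?F"
    using p by simp
  moreover have "((\<lambda>x. 1 - (norm (g x))\<^sup>2) \<longlongrightarrow> 1 - (norm p')\<^sup>2) ?F"
    by (intro tendsto_intros lim)
  ultimately have "1 - (norm p')\<^sup>2 = 0"
    using tendsto_unique[OF at_sphere_within_ball_neq_bot[OF p]] by blast
  then have p': "norm p' = 1"
    by (simp add: power2_eq_1_iff) (smt (verit) norm_ge_zero)
  have "((\<lambda>x. (norm x)\<^sup>2 * (1 - (norm b)\<^sup>2)\<^sup>2 / conformal_denom b x) \<longlongrightarrow>
      (norm p)\<^sup>2 * (1 - (norm b)\<^sup>2)\<^sup>2 / conformal_denom b p) ?F"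
    using Dp by (intro tendsto_intros Dlim) auto
  moreover have "\<forall>\<^sub>F x in ?F. (norm x)\<^sup>2 * (1 - (norm b)\<^sup>2)\<^sup>2 / conformal_denom b x = (norm (g x - g 0))\<^sup>2"
    by (rule eventually_mono[OF inb]) (simp add: ball_isometry_norm_diff[OF g b, where y = 0])
  ultimately have "((\<lambda>x. (norm (g x - g 0))\<^sup>2) \<longlongrightarrow> (norm p)\<^sup>2 * (1 - (norm b)\<^sup>2)\<^sup>2 / conformal_denom b p) ?F"
    by (rule Lim_transform_eventually)
  then have "((\<lambda>x. (norm (g x - g 0))\<^sup>2) \<longlongrightarrow> (1 - (norm b)\<^sup>2)\<^sup>2 / (norm (p - b))\<^sup>2) ?F"
    using p by (simp add: conformal_denom_sphere)
  moreover have "((\<lambda>x. (norm (g x - g 0))\<^sup>2) \<longlongrightarrow> (norm (p' - g 0))\<^sup>2) ?F"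
    by (intro tendsto_intros lim)
  ultimately have "(norm (p' - g 0))\<^sup>2 = (1 - (norm b)\<^sup>2)\<^sup>2 / (norm (p - b))\<^sup>2"
    using tendsto_unique[OF at_sphere_within_ball_neq_bot[OF p]] by blast
  moreover have "norm (p - b) > 0"
    using p b by auto
  ultimately have "(norm (p' - g 0) * norm (p - b))\<^sup>2 = (1 - (norm b)\<^sup>2)\<^sup>2"
    by (simp add: power_mult_distrib)
  then have "norm (p' - g 0) * norm (p - b) = 1 - (norm b)\<^sup>2"
    by (rule power2_eq_imp_eq) (simp, rule less_imp_le[OF one_minus_norm_sq_pos[OF b(1)]])
  with p' lim that show thesis by blast
qed

text \<open>
  A hyperbolic neighbourhood of bounded radius of a smaller concentric Euclidean ball is again
  contained in such a ball.
\<close>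

lemma sinh_sq_half_bounded_imp_norm_bounded:
  assumes "\<rho> < 1"
  obtains \<sigma> where "0 \<le> \<sigma>" "\<sigma> < 1"
    "\<And>a y. norm a \<le> \<rho> \<Longrightarrow> norm y < 1 \<Longrightarrow> sinh_sq_half y a \<le> M \<Longrightarrow> norm y \<le> \<sigma>"
proof -
  define M' where "M' = max M 1"
  define \<sigma> where "\<sigma> = max 0 (max ((1 + \<rho>) / 2) (sqrt (1 - ((1 - \<rho>) / 2)\<^sup>2 / M')))"
  have M': "M' > 0" "M \<le> M'" by (auto simp: M'_def)
  have "0 \<le> \<sigma>" "\<sigma> < 1"
    using assms M' by (simp_all add: \<sigma>_def)
  moreover have "norm y \<le> \<sigma>" if a: "norm a \<le> \<rho>" and y: "norm y < 1" and s: "sinh_sq_half y a \<le> M" for a y :: 'a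
  proof (cases "norm y \<le> (1 + \<rho>) / 2")
    case False
    have a1: "norm a < 1" using a assms by simp
    \<comment> \<open>Such a \<open>y\<close> is at Euclidean distance at least \<open>(1 - \<rho>) / 2\<close> from \<open>a\<close>, which
      bounds \<open>1 - \<bar>y\<bar>\<^sup>2\<close> from below.\<close>
    have "(1 - \<rho>) / 2 \<le> norm (y - a)"
      using False a norm_triangle_ineq2[of y a] by argo
    then have "((1 - \<rho>) / 2)\<^sup>2 \<le> (norm (y - a))\<^sup>2"
      using assms by (intro power_mono) auto
    also have "\<dots> = sinh_sq_half y a * ((1 - (norm y)\<^sup>2) * (1 - (norm a)\<^sup>2))"
      by (rule norm_diff_sq_eq[OF y a1])
    also have "\<dots> \<le> M' * ((1 - (norm y)\<^sup>2) * 1)"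
      using one_minus_norm_sq_pos[OF y] one_minus_norm_sq_pos[OF a1] s M'
      by (intro mult_mono) auto
    finally have "(norm y)\<^sup>2 \<le> 1 - ((1 - \<rho>) / 2)\<^sup>2 / M'"
      using M' by (simp add: field_simps)
    then have "norm y \<le> sqrt (1 - ((1 - \<rho>) / 2)\<^sup>2 / M')"
      by (rule real_le_rsqrt)
    then show ?thesis by (simp add: \<sigma>_def)
  qed (simp add: \<sigma>_def le_max_iff_disj)
  ultimately show thesis by (rule that)
qed

lemma sinh_sq_half_le:
  assumes "\<rho> < 1" "norm x \<le> \<rho>" "norm y \<le> \<rho>"
  shows "sinh_sq_half x y \<le> (norm (x - y))\<^sup>2 / (1 - \<rho>\<^sup>2)\<^sup>2"
proof -
  have "0 \<le> \<rho>" using assms norm_ge_zero order_trans by blast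
  then have "\<rho>\<^sup>2 < 1" using assms by (simp add: abs_square_less_1)
  moreover have "(norm x)\<^sup>2 \<le> \<rho>\<^sup>2" "(norm y)\<^sup>2 \<le> \<rho>\<^sup>2"
    using assms by (auto intro: power_mono)
  ultimately show ?thesis
    unfolding sinh_sq_half_def power2_eq_square[of "1 - \<rho>\<^sup>2"]
    by (intro divide_left_mono mult_mono mult_pos_pos) auto
qed

lemma norm_diff_sq_le_sinh_sq_half:
  assumes "norm x < 1" "norm y < 1"
  shows "(norm (x - y))\<^sup>2 \<le> sinh_sq_half x y"
proof -
  have "(1 - (norm x)\<^sup>2) * (1 - (norm y)\<^sup>2) \<le> 1 * 1"
    using assms[THEN one_minus_norm_sq_pos] by (intro mult_mono) auto
  then show ?thesis
    unfolding norm_diff_sq_eq[OF assms] using sinh_sq_half_nonneg[OF assms] by (simp add: mult_left_le)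
qed

section \<open>Discrete groups act properly discontinuously\<close>

abbreviation ball_group :: "(real ^ 'n \<Rightarrow> real ^ 'n) monoid"
  where "ball_group \<equiv> BijGroup hyperbolic_space"

lemma ball_group_one_apply: "x \<in> hyperbolic_space \<Longrightarrow> \<one>\<^bsub>ball_group\<^esub> x = x"
  by (simp add: BijGroup_def)

lemma ball_group_mult_apply:
  assumes "f \<in> Bij hyperbolic_space" "g \<in> Bij hyperbolic_space" "x \<in> hyperbolic_space"
  shows "(f \<otimes>\<^bsub>ball_group\<^esub> g) x = f (g x)"
  using assms by (simp add: BijGroup_def compose_def)

lemma ball_group_inv_apply:
  assumes "f \<in> Bij hyperbolic_space" "x \<in> hyperbolic_space"
  shows "(inv\<^bsub>ball_group\<^esub> f) (f x) = x"
proof -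
  have "f x \<in> hyperbolic_space"
    using assms by (auto simp: Bij_def dest: bij_betwE)
  moreover have "inj_on f hyperbolic_space"
    using assms by (auto simp: Bij_def bij_betw_def)
  ultimately show ?thesis
    using assms by (simp add: inv_BijGroup)
qed

lemma kleinian_group_ball_isometry: "kleinian_group \<Gamma> \<Longrightarrow> g \<in> \<Gamma> \<Longrightarrow> ball_isometry g"
  by (auto simp: kleinian_group_def intro: isom_plus_ball_isometry)

lemma kleinian_group_Bij: "kleinian_group \<Gamma> \<Longrightarrow> g \<in> \<Gamma> \<Longrightarrow> g \<in> Bij hyperbolic_space"
  by (auto simp: kleinian_group_def isom_plus_def)

lemma kleinian_group_subgroup: "kleinian_group \<Gamma> \<Longrightarrow> subgroup \<Gamma> ball_group"
  by (simp add: kleinian_group_def)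

text \<open>
  A basic neighbourhood of the identity in the product topology constrains only finitely many
  values. Those at points outside the ball carry no condition, since all elements of the group have
  the same value there.
\<close>

lemma kleinian_group_identity_isolated:
  fixes \<Gamma> :: "(real ^ 'n \<Rightarrow> real ^ 'n) set"
  assumes "kleinian_group \<Gamma>"
  obtains X \<epsilon> where "finite X" "X \<subseteq> hyperbolic_space" "\<epsilon> > 0"
    "\<And>g. g \<in> \<Gamma> \<Longrightarrow> (\<And>x. x \<in> X \<Longrightarrow> norm (g x - x) < \<epsilon>) \<Longrightarrow> g = \<one>\<^bsub>ball_group\<^esub>"
proof -
  let ?e = "\<one>\<^bsub>ball_group\<^esub> :: real ^ 'n \<Rightarrow> real ^ 'n"
  have "?e \<in> \<Gamma>"
    using kleinian_group_subgroup[OF assms] by (rule subgroup.one_closed)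
  then obtain T where T: "open T" "T \<inter> \<Gamma> = {?e}"
    using assms by (auto simp: kleinian_group_def discrete_def isolated_in_def)
  then obtain U where U: "?e \<in> Pi\<^sub>E UNIV U" "\<And>i. open (U i)" "finite {i. U i \<noteq> UNIV}" "Pi\<^sub>E UNIV U \<subseteq> T"
    using product_topology_open_contains_basis[of "\<lambda>_. euclidean" UNIV T ?e]
    by (auto simp: open_fun_def)
  define X where "X = hyperbolic_space \<inter> {i. U i \<noteq> UNIV}"
  have X: "finite X" "X \<subseteq> hyperbolic_space"
    using U(3) by (auto simp: X_def)
  have "\<exists>e>0. ball x e \<subseteq> U x" if "x \<in> X" for x
  proof -
    have "x \<in> U x"
      using U(1) that ball_group_one_apply[of x] by (simp add: X_def PiE_iff) metis
    then show ?thesis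
      using U(2) open_contains_ball by blast
  qed
  then obtain e where e: "\<And>x. x \<in> X \<Longrightarrow> e x > 0 \<and> ball x (e x) \<subseteq> U x"
    by metis
  define \<epsilon> where "\<epsilon> = Min (insert 1 (e ` X))"
  have \<epsilon>: "\<epsilon> > 0" "\<And>x. x \<in> X \<Longrightarrow> \<epsilon> \<le> e x"
    using X e by (auto simp: \<epsilon>_def)
  have "g = ?e" if g: "g \<in> \<Gamma>" and close: "\<And>x. x \<in> X \<Longrightarrow> norm (g x - x) < \<epsilon>" for g
  proof -
    have "g i \<in> U i" for i
    proof (cases "i \<in> hyperbolic_space")
      case True
      then show ?thesis
        using close[of i] \<epsilon>(2)[of i] e[of i]
        by (force simp: X_def dist_norm norm_minus_commute)
    next
      case False
      then have "g i = ?e i"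
        using kleinian_group_Bij[OF assms g] by (auto simp: BijGroup_def Bij_def extensional_def)
      then show ?thesis
        using U(1) by (auto simp: PiE_iff)
    qed
    then have "g \<in> T" using U(4) by (auto simp: PiE_iff)
    then show ?thesis using T g by blast
  qed
  then show thesis
    by (rule that[OF X \<epsilon>(1)])
qed

lemma bounded_imp_finite_ball_cover:
  fixes A :: "'b::heine_borel set"
  assumes "bounded A" "e > 0"
  obtains C where "finite C" "A \<subseteq> (\<Union>c\<in>C. ball c e)"
proof -
  have "\<exists>k. finite k \<and> closure A \<subseteq> (\<Union>x\<in>k. ball x e)"
    using assms compact_eq_totally_bounded[of "closure A"] compact_closure[of A] by simp
  then show thesis using that closure_subset[of A] by (meson subset_trans)
qed

lemma infinite_subfamily_close_on_finite_set:
  fixes S :: "('a \<Rightarrow> 'b::heine_borel) set"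
  assumes "finite X" "infinite S" "\<And>x. x \<in> X \<Longrightarrow> bounded ((\<lambda>g. g x) ` S)" "\<epsilon> > 0"
  shows "\<exists>T\<subseteq>S. infinite T \<and> (\<forall>x\<in>X. \<forall>g\<in>T. \<forall>h\<in>T. dist (g x) (h x) < \<epsilon>)"
  using assms(1,3)
proof (induction X rule: finite_induct)
  case empty
  then show ?case using assms(2) by auto
next
  case (insert x X)
  then obtain T where T: "T \<subseteq> S" "infinite T" "\<forall>x\<in>X. \<forall>g\<in>T. \<forall>h\<in>T. dist (g x) (h x) < \<epsilon>"
    by auto
  obtain C where C: "finite C" "(\<lambda>g. g x) ` S \<subseteq> (\<Union>c\<in>C. ball c (\<epsilon> / 2))"
    using bounded_imp_finite_ball_cover[of "(\<lambda>g. g x) ` S" "\<epsilon> / 2"] insert.prems[of x] assms(4) by auto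
  have "\<forall>g\<in>T. \<exists>c\<in>C. dist c (g x) < \<epsilon> / 2"
  proof
    fix g assume "g \<in> T"
    then have "g x \<in> (\<Union>c\<in>C. ball c (\<epsilon> / 2))"
      using T(1) C(2) by blast
    then show "\<exists>c\<in>C. dist c (g x) < \<epsilon> / 2"
      by auto
  qed
  from pigeonhole_infinite_rel[where R = "\<lambda>g c. dist c (g x) < \<epsilon> / 2", OF T(2) C(1) this]
  obtain c where c: "infinite {g \<in> T. dist c (g x) < \<epsilon> / 2}"
    by blast
  have "dist (g x) (h x) < \<epsilon>" if "dist c (g x) < \<epsilon> / 2" "dist c (h x) < \<epsilon> / 2" for g h
    using dist_triangle_half_r that by blast
  with T c show ?case
    by (intro exI[of _ "{g \<in> T. dist c (g x) < \<epsilon> / 2}"]) auto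
qed

text \<open>
  Infinitely many such elements would move the finitely many test points of
  \<open>kleinian_group_identity_isolated\<close> within a fixed smaller ball, so two distinct ones
  \<open>g\<close>, \<open>h\<close> would nearly agree at all of them. Then \<open>h\<inverse> g\<close> would nearly fix all of the test points
  and hence be the identity. A finite pigeonhole thus takes the place of a compactness theorem for
  spaces of isometries.
\<close>

theorem kleinian_group_properly_discontinuous:
  fixes \<Gamma> :: "(real ^ 'n \<Rightarrow> real ^ 'n) set"
  assumes \<Gamma>: "kleinian_group \<Gamma>" and \<rho>: "\<rho> < 1"
  shows "finite {g \<in> \<Gamma>. \<exists>b. norm b \<le> \<rho> \<and> norm (g b) \<le> \<rho>}" (is "finite ?S")
proof (rule ccontr)
  assume inf: "infinite ?S"
  interpret subgroup \<Gamma> ball_group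
    by (rule kleinian_group_subgroup[OF \<Gamma>])
  interpret group ball_group
    by (rule group_BijGroup)
  obtain X \<epsilon> where X: "finite X" "X \<subseteq> hyperbolic_space" and \<epsilon>: "\<epsilon> > 0"
    and iso: "\<And>g. g \<in> \<Gamma> \<Longrightarrow> (\<And>x. x \<in> X \<Longrightarrow> norm (g x - x) < \<epsilon>) \<Longrightarrow> g = \<one>\<^bsub>ball_group\<^esub>"
    using kleinian_group_identity_isolated[OF \<Gamma>] by blast
  note gball = kleinian_group_ball_isometry[OF \<Gamma>, THEN ball_isometry_norm_less]
  obtain \<tau> where \<tau>: "\<tau> < 1" "\<rho> \<le> \<tau>" "\<And>x. x \<in> X \<Longrightarrow> norm x \<le> \<tau>"
  proof
    show "Max (insert \<rho> (norm ` X)) < 1"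
      using X \<rho> by auto
  qed (use X in auto)
  obtain \<sigma> where \<sigma>0: "0 \<le> \<sigma>" and \<sigma>: "\<sigma> < 1" "\<And>a y :: real ^ 'n. norm a \<le> \<tau> \<Longrightarrow> norm y < 1 \<Longrightarrow>
      sinh_sq_half y a \<le> (2 * \<tau>)\<^sup>2 / (1 - \<tau>\<^sup>2)\<^sup>2 \<Longrightarrow> norm y \<le> \<sigma>"
    using sinh_sq_half_bounded_imp_norm_bounded[OF \<tau>(1)] by blast
  have bnd: "norm (g x) \<le> \<sigma>" if gS: "g \<in> ?S" and xX: "x \<in> X" for g x
  proof -
    obtain b where b: "norm b \<le> \<rho>" "norm (g b) \<le> \<rho>" and g: "g \<in> \<Gamma>"
      using gS by blast
    have x1: "norm x < 1" and b1: "norm b < 1"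
      using X xX b \<rho> by auto
    have "norm (x - b) \<le> 2 * \<tau>"
      using norm_triangle_ineq4[of x b] \<tau>(2) \<tau>(3)[OF xX] b by linarith
    then have "(norm (x - b))\<^sup>2 / (1 - \<tau>\<^sup>2)\<^sup>2 \<le> (2 * \<tau>)\<^sup>2 / (1 - \<tau>\<^sup>2)\<^sup>2"
      by (intro divide_right_mono power_mono) auto
    moreover have "sinh_sq_half x b \<le> (norm (x - b))\<^sup>2 / (1 - \<tau>\<^sup>2)\<^sup>2"
      using \<tau> b xX by (intro sinh_sq_half_le) auto
    moreover have "sinh_sq_half (g x) (g b) = sinh_sq_half x b"
      by (rule ball_isometry_preserves[OF kleinian_group_ball_isometry[OF \<Gamma> g] x1 b1])
    ultimately show ?thesis
      using \<sigma>(2)[of "g b" "g x"] b \<tau> gball[OF g x1] by auto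
  qed
  \<comment> \<open>On \<open>cball 0 \<sigma>\<close> points at Euclidean distance less than \<open>\<eta>\<close> have \<open>sinh_sq_half\<close> less than
    \<open>\<epsilon>\<^sup>2\<close>; this bound is kept by \<open>h\<inverse>\<close> and then gives Euclidean distance less than \<open>\<epsilon>\<close>.\<close>
  define \<eta> where "\<eta> = \<epsilon> * (1 - \<sigma>\<^sup>2)"
  have \<sigma>2: "1 - \<sigma>\<^sup>2 > 0"
    using \<sigma>0 \<sigma>(1) by (simp add: abs_square_less_1)
  have \<eta>: "\<eta> > 0"
    using \<sigma>2 \<epsilon> by (simp add: \<eta>_def)
  have "\<exists>T\<subseteq>?S. infinite T \<and> (\<forall>x\<in>X. \<forall>g\<in>T. \<forall>h\<in>T. dist (g x) (h x) < \<eta>)"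
    using X(1) inf \<eta> bnd
    by (intro infinite_subfamily_close_on_finite_set) (auto simp: bounded_iff intro!: exI[of _ \<sigma>])
  then obtain T where T: "T \<subseteq> ?S" "infinite T" "\<forall>x\<in>X. \<forall>g\<in>T. \<forall>h\<in>T. dist (g x) (h x) < \<eta>"
    by blast
  obtain g where g: "g \<in> T" using infinite_imp_nonempty[OF T(2)] by blast
  have "infinite (T - {g})" using T(2) by simp
  then obtain h where h: "h \<in> T" "h \<noteq> g" using infinite_imp_nonempty by blast
  have gh: "g \<in> \<Gamma>" "h \<in> \<Gamma>" using g h T by auto
  let ?f = "inv\<^bsub>ball_group\<^esub> h \<otimes>\<^bsub>ball_group\<^esub> g"
  have invh: "inv\<^bsub>ball_group\<^esub> h \<in> \<Gamma>" and f: "?f \<in> \<Gamma>"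
    using gh by (auto intro: m_inv_closed m_closed)
  have "?f = \<one>\<^bsub>ball_group\<^esub>"
  proof (rule iso[OF f])
    fix x assume x: "x \<in> X"
    then have x1: "norm x < 1" and xb: "x \<in> hyperbolic_space" using X by auto
    have "(norm (?f x - x))\<^sup>2 \<le> sinh_sq_half (?f x) x"
      using gball[OF f x1] x1 by (rule norm_diff_sq_le_sinh_sq_half)
    also have "\<dots> = sinh_sq_half ((inv\<^bsub>ball_group\<^esub> h) (g x)) ((inv\<^bsub>ball_group\<^esub> h) (h x))"
      using kleinian_group_Bij[OF \<Gamma>] gh invh xb
      by (simp add: ball_group_mult_apply ball_group_inv_apply del: mem_ball)
    also have "\<dots> = sinh_sq_half (g x) (h x)"
      by (rule ball_isometry_preserves[OF kleinian_group_ball_isometry[OF \<Gamma> invh] gball[OF gh(1) x1] gball[OF gh(2) x1]])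
    also have "\<dots> \<le> (norm (g x - h x))\<^sup>2 / (1 - \<sigma>\<^sup>2)\<^sup>2"
      using bnd[of g x] bnd[of h x] g h T x \<sigma>(1) by (intro sinh_sq_half_le) auto
    also have "\<dots> < \<eta>\<^sup>2 / (1 - \<sigma>\<^sup>2)\<^sup>2"
      using T(3) x g h(1) \<sigma>2
      by (intro divide_strict_right_mono power_strict_mono) (auto simp: dist_norm)
    also have "\<dots> = \<epsilon>\<^sup>2"
      using \<sigma>2 by (simp add: \<eta>_def power_mult_distrib)
    finally show "norm (?f x - x) < \<epsilon>"
      using \<epsilon> by (simp add: power2_less_imp_less)
  qed
  then have "inv\<^bsub>ball_group\<^esub> g = inv\<^bsub>ball_group\<^esub> h"
    using gh mem_carrier by (intro inv_equality) auto
  then have "inv\<^bsub>ball_group\<^esub> (inv\<^bsub>ball_group\<^esub> g) = inv\<^bsub>ball_group\<^esub> (inv\<^bsub>ball_group\<^esub> h)"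
    by (rule arg_cong)
  then have "g = h"
    using gh mem_carrier by simp
  with h show False by simp
qed

section \<open>Intersecting the two groups along a ray\<close>

lemma compact_hyperbolic_norm_bound:
  fixes K :: "(real ^ 'n) set"
  assumes "compact K" "K \<subseteq> hyperbolic_space"
  obtains \<rho> where "0 \<le> \<rho>" "\<rho> < 1" "\<And>z. z \<in> K \<Longrightarrow> norm z \<le> \<rho>"
proof (cases "K = {}")
  case False
  then obtain m where m: "m \<in> K" "\<forall>z\<in>K. norm z \<le> norm m"
    using continuous_attains_sup[OF assms(1) _ continuous_on_norm_id] by blast
  then show thesis
    using that[of "norm m"] assms(2) by force
qed (use that[of 0] in auto)

text \<open>
  Each point \<open>\<phi>\<^sub>k a\<^sub>k\<close> of the ray also has the form \<open>\<theta>\<^sub>j b\<^sub>k\<close>, because the translates by \<open>\<theta>\<close> cover the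
  whole ray. Then \<open>\<phi>\<^sub>k\<inverse> \<theta>\<^sub>j\<close> maps a point of \<open>L\<close> into \<open>K\<close>, so it takes only finitely many values.
  Where it takes the same value at \<open>k\<close> and \<open>k0\<close>, the quotient \<open>\<phi>\<^sub>k \<phi>\<^bsub>k0\<^esub>\<inverse>\<close> lies in both groups,
  and it carries \<open>\<phi>\<^bsub>k0\<^esub> a\<^sub>k\<close> to the given point of the ray.
\<close>

proposition conical_sequence_inter:
  fixes \<Gamma> \<Phi> \<Theta> :: "(real ^ 'n \<Rightarrow> real ^ 'n) set"
  assumes \<Gamma>: "kleinian_group \<Gamma>"
    and \<Phi>: "subgroup \<Phi> ball_group" "\<Phi> \<subseteq> \<Gamma>" and \<Theta>: "subgroup \<Theta> ball_group" "\<Theta> \<subseteq> \<Gamma>"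
    and K: "compact K" "K \<subseteq> hyperbolic_space"
    and \<phi>: "inj (\<phi> :: nat \<Rightarrow> _)" "range \<phi> \<subseteq> \<Phi>" "\<And>k. \<phi> k ` K \<inter> r \<noteq> {}"
    and L: "compact L" "L \<subseteq> hyperbolic_space"
    and \<theta>: "range \<theta> \<subseteq> \<Theta>" "r \<subseteq> (\<Union>j::nat. \<theta> j ` L)"
  shows "\<exists>M (\<psi> :: nat \<Rightarrow> _). compact M \<and> M \<subseteq> hyperbolic_space \<and> inj \<psi> \<and> range \<psi> \<subseteq> \<Phi> \<inter> \<Theta> \<and>
    (\<forall>k. \<psi> k ` M \<inter> r \<noteq> {})"
proof -
  interpret group "ball_group :: (real ^ 'n \<Rightarrow> real ^ 'n) monoid"
    by (rule group_BijGroup)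
  interpret P: subgroup \<Phi> ball_group by (rule \<Phi>)
  interpret Q: subgroup \<Theta> ball_group by (rule \<Theta>)
  interpret G: subgroup \<Gamma> ball_group by (rule kleinian_group_subgroup[OF \<Gamma>])
  have \<phi>P: "\<phi> k \<in> \<Phi>" and \<theta>Q: "\<theta> k \<in> \<Theta>" for k
    using \<phi> \<theta> by auto
  have \<phi>G: "\<phi> k \<in> \<Gamma>" and \<theta>G: "\<theta> k \<in> \<Gamma>" for k
    using \<phi>P \<theta>Q \<Phi> \<Theta> by auto
  note Bij = kleinian_group_Bij[OF \<Gamma>]
  note app = ball_group_mult_apply[OF Bij Bij] ball_group_inv_apply[OF Bij]
  obtain \<rho> where \<rho>: "\<rho> < 1" "\<And>z. z \<in> K \<union> L \<Longrightarrow> norm z \<le> \<rho>"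
    using compact_hyperbolic_norm_bound[of "K \<union> L"] K L by (metis compact_Un le_sup_iff)
  have "\<exists>a j b. a \<in> K \<and> \<phi> k a \<in> r \<and> b \<in> L \<and> \<theta> j b = \<phi> k a" for k
    using \<phi>(3)[of k] \<theta>(2) by fastforce
  then obtain a j b where
    ajb: "\<And>k. a k \<in> K" "\<And>k. \<phi> k (a k) \<in> r" "\<And>k. b k \<in> L" "\<And>k. \<theta> (j k) (b k) = \<phi> k (a k)"
    by metis
  define \<gamma> where "\<gamma> k = inv\<^bsub>ball_group\<^esub> (\<phi> k) \<otimes>\<^bsub>ball_group\<^esub> \<theta> (j k)" for k
  have "\<gamma> k \<in> \<Gamma> \<and> norm (b k) \<le> \<rho> \<and> norm (\<gamma> k (b k)) \<le> \<rho>" for k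
  proof -
    have "b k \<in> hyperbolic_space" "a k \<in> hyperbolic_space"
      using ajb(1,3)[of k] K(2) L(2) by blast+
    then have "\<gamma> k (b k) = a k"
      using \<phi>G \<theta>G by (simp add: \<gamma>_def app ajb G.m_inv_closed del: mem_ball)
    then show ?thesis
      using ajb \<rho>(2) \<phi>G \<theta>G by (simp add: \<gamma>_def)
  qed
  then have "range \<gamma> \<subseteq> {g \<in> \<Gamma>. \<exists>b. norm b \<le> \<rho> \<and> norm (g b) \<le> \<rho>}"
    by blast
  then have "finite (range \<gamma>)"
    by (rule finite_subset[OF _ kleinian_group_properly_discontinuous[OF \<Gamma> \<rho>(1)]])
  then obtain k0 where "infinite {k. \<gamma> k = \<gamma> k0}"
    using pigeonhole_infinite[of "UNIV :: nat set" \<gamma>] by auto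
  then obtain s :: "nat \<Rightarrow> nat" where s: "strict_mono s" "\<And>n. \<gamma> (s n) = \<gamma> k0"
    using infinite_enumerate by force
  define \<psi> where "\<psi> n = \<phi> (s n) \<otimes>\<^bsub>ball_group\<^esub> inv\<^bsub>ball_group\<^esub> (\<phi> k0)" for n
  have \<psi>eq: "\<psi> n = \<theta> (j (s n)) \<otimes>\<^bsub>ball_group\<^esub> inv\<^bsub>ball_group\<^esub> (\<theta> (j k0))" for n
  proof -
    note c = P.mem_carrier[OF \<phi>P] Q.mem_carrier[OF \<theta>Q]
    have "\<theta> (j (s n)) = \<phi> (s n) \<otimes>\<^bsub>ball_group\<^esub> \<gamma> (s n)"
      by (simp add: \<gamma>_def c m_assoc[symmetric])
    also have "\<dots> = \<phi> (s n) \<otimes>\<^bsub>ball_group\<^esub> inv\<^bsub>ball_group\<^esub> (\<phi> k0) \<otimes>\<^bsub>ball_group\<^esub> \<theta> (j k0)"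
      unfolding s(2) by (simp add: \<gamma>_def c m_assoc)
    finally show ?thesis
      by (simp add: \<psi>_def c m_assoc)
  qed
  have inj: "inj \<psi>"
  proof (rule injI)
    fix m n assume "\<psi> m = \<psi> n"
    then have "\<phi> (s m) = \<phi> (s n)"
      using P.mem_carrier[OF \<phi>P] by (simp add: \<psi>_def)
    then show "m = n"
      using \<phi>(1) s(1) by (auto dest!: injD strict_mono_imp_inj_on)
  qed
  have "\<psi> n \<in> \<Phi>" for n
    by (simp add: \<psi>_def \<phi>P)
  moreover have "\<psi> n \<in> \<Theta>" for n
    by (simp add: \<psi>eq \<theta>Q)
  ultimately have "range \<psi> \<subseteq> \<Phi> \<inter> \<Theta>"
    by blast
  moreover have "continuous_on hyperbolic_space (\<phi> k0)"
    by (rule uniformly_continuous_imp_continuous[OF ball_isometry_uniformly_continuous[OF kleinian_group_ball_isometry[OF \<Gamma> \<phi>G]]])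
  then have "compact (\<phi> k0 ` K)"
    using K by (blast intro: compact_continuous_image continuous_on_subset)
  moreover have "\<phi> k0 ` K \<subseteq> hyperbolic_space"
    using K ball_isometry_norm_less[OF kleinian_group_ball_isometry[OF \<Gamma> \<phi>G]] by auto
  moreover have "\<psi> n ` (\<phi> k0 ` K) \<inter> r \<noteq> {}" for n
  proof -
    have "a (s n) \<in> hyperbolic_space"
      using ajb(1)[of "s n"] K(2) by blast
    moreover from this have "\<phi> k0 (a (s n)) \<in> hyperbolic_space"
      using ball_isometry_norm_less[OF kleinian_group_ball_isometry[OF \<Gamma> \<phi>G]] by auto
    ultimately have "\<psi> n (\<phi> k0 (a (s n))) = \<phi> (s n) (a (s n))"
      using \<phi>G by (simp add: \<psi>_def app G.m_inv_closed del: mem_ball)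
    then show ?thesis
      using ajb(1,2)[of "s n"] by (intro ex_in_conv[THEN iffD1] exI[of _ "\<phi> (s n) (a (s n))"]) force
  qed
  ultimately show ?thesis using inj by blast
qed

section \<open>Accumulation points of orbits are limit points\<close>

lemma ball_isometry_filterlim_sphere:
  fixes g :: "'a::euclidean_space \<Rightarrow> 'a"
  assumes g: "ball_isometry g" and lim: "(g \<longlongrightarrow> y) (at x within ball 0 1)" and y: "norm y = 1"
  shows "filterlim g (at y within ball 0 1) (at x within ball 0 1)"
proof -
  have "\<forall>\<^sub>F z in at x within ball 0 1. g z \<in> ball 0 1 \<and> g z \<noteq> y"
    unfolding eventually_at_filter
    using ball_isometry_norm_less[OF g] y by (intro always_eventually) force
  then show ?thesis
    unfolding filterlim_at using lim by blast
qed

text \<open>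
  The boundary value of \<open>g\<inverse>\<close> at \<open>p'\<close> is \<open>p\<close>, because \<open>g\<inverse> (g z) = z\<close> tends to \<open>p\<close> as \<open>z\<close> does.
  The claim follows by composing the limits of \<open>g\<inverse>\<close>, \<open>h\<close> and \<open>g\<close>.
\<close>

lemma conjugate_fixes_at_infinity:
  fixes \<Gamma> :: "(real ^ 'n \<Rightarrow> real ^ 'n) set"
  assumes \<Gamma>: "kleinian_group \<Gamma>" and g: "g \<in> \<Gamma>" and h: "h \<in> \<Gamma>"
    and p: "fixes_at_infinity h p" and p': "norm p' = 1" "(g \<longlongrightarrow> p') (at p within hyperbolic_space)"
  shows "fixes_at_infinity (g \<otimes>\<^bsub>ball_group\<^esub> h \<otimes>\<^bsub>ball_group\<^esub> inv\<^bsub>ball_group\<^esub> g) p'"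
proof -
  interpret subgroup \<Gamma> ball_group
    by (rule kleinian_group_subgroup[OF \<Gamma>])
  interpret group "ball_group :: (real ^ 'n \<Rightarrow> real ^ 'n) monoid"
    by (rule group_BijGroup)
  let ?k = "inv\<^bsub>ball_group\<^esub> g"
  note iso = kleinian_group_ball_isometry[OF \<Gamma>]
  have k: "?k \<in> \<Gamma>" using g by simp
  have pn: "norm p = 1" and hp: "(h \<longlongrightarrow> p) (at p within hyperbolic_space)"
    using p by (auto simp: fixes_at_infinity_def)
  obtain b where b: "norm b < 1" "?k b = 0"
    using ball_isometry_obtain_zero[OF iso[OF k]] by blast
  obtain q where q: "norm q = 1" "(?k \<longlongrightarrow> q) (at p' within hyperbolic_space)"
    using ball_isometry_boundary[OF iso[OF k] b p'(1)] by blast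
  have flg: "filterlim g (at p' within hyperbolic_space) (at p within hyperbolic_space)"
    by (rule ball_isometry_filterlim_sphere[OF iso[OF g] p'(2,1)])
  have "((\<lambda>z. ?k (g z)) \<longlongrightarrow> q) (at p within hyperbolic_space)"
    by (rule filterlim_compose[OF q(2) flg])
  moreover have "\<forall>\<^sub>F z in at p within hyperbolic_space. ?k (g z) = z"
    unfolding eventually_at_filter
    using ball_group_inv_apply[OF kleinian_group_Bij[OF \<Gamma> g]] by (intro always_eventually) blast
  ultimately have "((\<lambda>z. z) \<longlongrightarrow> q) (at p within hyperbolic_space)"
    by (rule Lim_transform_eventually)
  moreover have "((\<lambda>z. z) \<longlongrightarrow> p) (at p within hyperbolic_space)"
    by (rule tendsto_ident_at)
  ultimately have "q = p"
    by (rule tendsto_unique[OF at_sphere_within_ball_neq_bot[OF pn]])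
  then have flk: "filterlim ?k (at p within hyperbolic_space) (at p' within hyperbolic_space)"
    using ball_isometry_filterlim_sphere[OF iso[OF k] q(2,1)] by simp
  have flh: "filterlim h (at p within hyperbolic_space) (at p within hyperbolic_space)"
    by (rule ball_isometry_filterlim_sphere[OF iso[OF h] hp pn])
  have "((\<lambda>z. g (h (?k z))) \<longlongrightarrow> p') (at p' within hyperbolic_space)"
    by (rule filterlim_compose[OF filterlim_compose[OF p'(2) flh] flk])
  moreover have "\<forall>\<^sub>F z in at p' within hyperbolic_space.
      g (h (?k z)) = (g \<otimes>\<^bsub>ball_group\<^esub> h \<otimes>\<^bsub>ball_group\<^esub> ?k) z"
    unfolding eventually_at_filter
  proof (intro always_eventually allI impI)
    fix z :: "real ^ 'n" assume z: "z \<in> hyperbolic_space"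
    then have "?k z \<in> hyperbolic_space"
      using ball_isometry_norm_less[OF iso[OF k]] by simp
    then show "g (h (?k z)) = (g \<otimes>\<^bsub>ball_group\<^esub> h \<otimes>\<^bsub>ball_group\<^esub> ?k) z"
      using z kleinian_group_Bij[OF \<Gamma>] g h k by (simp add: ball_group_mult_apply m_closed del: mem_ball)
  qed
  ultimately have "(g \<otimes>\<^bsub>ball_group\<^esub> h \<otimes>\<^bsub>ball_group\<^esub> ?k \<longlongrightarrow> p') (at p' within hyperbolic_space)"
    by (rule Lim_transform_eventually)
  then show ?thesis
    using p'(1) by (simp add: fixes_at_infinity_def)
qed

text \<open>
  An isometry that sends the origin close to the sphere contracts all of the sphere except a small
  neighbourhood of \<open>b = g\<inverse> 0\<close> towards \<open>g 0\<close>. Of two distinct points \<open>p\<close>, \<open>q\<close>, at least one is at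
  distance \<open>\<bar>p - q\<bar> / 2\<close> or more from \<open>b\<close>.
\<close>

lemma ball_isometry_endpoint_near_orbit:
  fixes g :: "'a::euclidean_space \<Rightarrow> 'a"
  assumes g: "ball_isometry g" and p: "norm p = 1" and q: "norm q = 1"
  obtains z z' where "z \<in> {p, q}" "norm z' = 1" "(g \<longlongrightarrow> z') (at z within ball 0 1)"
    "norm (z' - g 0) * norm (p - q) \<le> 2 * (1 - (norm (g 0))\<^sup>2)"
proof -
  obtain b where b: "norm b < 1" "g b = 0" "norm b = norm (g 0)"
    using ball_isometry_obtain_zero[OF g] by blast
  have "norm (p - q) \<le> norm (p - b) + norm (q - b)"
    using norm_triangle_ineq4[of "p - b" "q - b"] by simp
  then obtain z where z: "z \<in> {p, q}" "norm (p - q) \<le> 2 * norm (z - b)"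
    by (cases "norm (p - b) \<le> norm (q - b)") force+
  then have "norm z = 1" using p q by auto
  from ball_isometry_boundary[OF g b(1,2) this] obtain z' where z': "norm z' = 1"
    "(g \<longlongrightarrow> z') (at z within ball 0 1)" "norm (z' - g 0) * norm (z - b) = 1 - (norm b)\<^sup>2"
    by blast
  have "norm (z' - g 0) * norm (p - q) \<le> norm (z' - g 0) * (2 * norm (z - b))"
    using z(2) by (intro mult_left_mono) auto
  also have "\<dots> = 2 * (1 - (norm (g 0))\<^sup>2)"
    using z'(3) b(3) by simp
  finally show thesis using that z(1) z'(1,2) by blast
qed

lemma loxodromic_fixed_points:
  assumes "loxodromic h"
  obtains p q where "p \<noteq> q" "fixes_at_infinity h p" "fixes_at_infinity h q"
proof -
  have "card {x. fixes_at_infinity h x} = 2"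
    using assms by (simp add: loxodromic_def)
  then obtain p q where "{x. fixes_at_infinity h x} = {p, q}" "p \<noteq> q"
    by (auto simp: card_2_iff)
  then show thesis using that by blast
qed

text \<open>
  Conjugating \<open>h\<close> by an element \<open>g\<close> moves its fixed points to their images under \<open>g\<close>, and one of
  these images is close to \<open>g 0\<close>, hence to \<open>x\<close>, when \<open>g 0\<close> is close to \<open>x\<close>.
\<close>

proposition orbit_accumulation_in_limit_set:
  fixes \<Gamma> H :: "(real ^ 'n \<Rightarrow> real ^ 'n) set"
  assumes \<Gamma>: "kleinian_group \<Gamma>" "purely_loxodromic \<Gamma>" and H: "subgroup H ball_group" "H \<subseteq> \<Gamma>"
    and h: "h \<in> H" "h \<noteq> \<one>\<^bsub>ball_group\<^esub>" and x: "norm x = 1"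
    and acc: "\<And>\<epsilon>. \<epsilon> > 0 \<Longrightarrow> \<exists>g\<in>H. norm (g 0 - x) < \<epsilon>"
  shows "x \<in> limit_set H"
proof -
  interpret group "ball_group :: (real ^ 'n \<Rightarrow> real ^ 'n) monoid"
    by (rule group_BijGroup)
  interpret H: subgroup H ball_group by (rule H)
  have "loxodromic h"
    using \<Gamma>(2) h H(2) by (auto simp: purely_loxodromic_def)
  then obtain p q where pq: "p \<noteq> q" "fixes_at_infinity h p" "fixes_at_infinity h q"
    by (rule loxodromic_fixed_points)
  then have pqn: "norm p = 1" "norm q = 1"
    by (auto simp: fixes_at_infinity_def)
  show ?thesis
    unfolding limit_set_def closure_approachable
  proof (intro allI impI)
    fix \<epsilon> :: real assume \<epsilon>: "\<epsilon> > 0"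
    define d where "d = norm (p - q)"
    have d: "d > 0" using pq by (simp add: d_def)
    \<comment> \<open>The fixed point lies within \<open>4 \<delta> / d\<close> of \<open>g 0\<close>, and \<open>g 0\<close> within \<open>\<delta>\<close> of \<open>x\<close>.\<close>
    define \<delta> where "\<delta> = min (\<epsilon> / 2) (\<epsilon> * d / 8)"
    have \<delta>: "\<delta> > 0" "\<delta> \<le> \<epsilon> / 2" "\<delta> \<le> \<epsilon> * d / 8"
      using \<epsilon> d by (auto simp: \<delta>_def)
    obtain g where g: "g \<in> H" "norm (g 0 - x) < \<delta>"
      using acc[OF \<delta>(1)] by blast
    have gG: "g \<in> \<Gamma>" and hG: "h \<in> \<Gamma>" using g h H(2) by auto
    note gi = kleinian_group_ball_isometry[OF \<Gamma>(1) gG]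
    obtain z z' where z: "z \<in> {p, q}" "norm z' = 1" "(g \<longlongrightarrow> z') (at z within hyperbolic_space)"
      "norm (z' - g 0) * d \<le> 2 * (1 - (norm (g 0))\<^sup>2)"
      using ball_isometry_endpoint_near_orbit[OF gi pqn] unfolding d_def by blast
    have g1: "norm (g 0) < 1" using ball_isometry_norm_less[OF gi, of 0] by simp
    have "1 - norm (g 0) \<le> norm (g 0 - x)"
      using norm_triangle_ineq2[of x "g 0"] x by (simp add: norm_minus_commute)
    then have gd: "1 - norm (g 0) < \<delta>" using g(2) by linarith
    have "1 - (norm (g 0))\<^sup>2 \<le> 2 * (1 - norm (g 0))"
      using sum_power2_ge_zero[of "1 - norm (g 0)" 0] by (simp add: power2_eq_square algebra_simps)
    also have "\<dots> < 2 * \<delta>" using gd by simp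
    finally have "2 * (1 - (norm (g 0))\<^sup>2) < 2 * (2 * \<delta>)" by (rule mult_strict_left_mono) simp
    with z(4) have "norm (z' - g 0) * d < 2 * (2 * \<delta>)" by (rule le_less_trans)
    also have "\<dots> \<le> \<epsilon> / 2 * d" using \<delta>(3) by simp
    finally have "norm (z' - g 0) < \<epsilon> / 2" using d by simp
    then have close: "dist z' x < \<epsilon>"
      using g(2) \<delta>(2) norm_triangle_ineq[of "z' - g 0" "g 0 - x"] by (simp add: dist_norm)
    let ?f = "g \<otimes>\<^bsub>ball_group\<^esub> h \<otimes>\<^bsub>ball_group\<^esub> inv\<^bsub>ball_group\<^esub> g"
    have f: "?f \<in> H" using g h by simp
    have "?f \<noteq> \<one>\<^bsub>ball_group\<^esub>"
    proof
      assume "?f = \<one>\<^bsub>ball_group\<^esub>"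
      then have "?f \<otimes>\<^bsub>ball_group\<^esub> g = \<one>\<^bsub>ball_group\<^esub> \<otimes>\<^bsub>ball_group\<^esub> g"
        by simp
      then have "g \<otimes>\<^bsub>ball_group\<^esub> h = g"
        using g(1) h(1) by (simp add: m_assoc)
      then show False
        using g(1) h by simp
    qed
    then have "loxodromic ?f"
      using \<Gamma>(2) f H(2) by (auto simp: purely_loxodromic_def)
    moreover have "fixes_at_infinity ?f z'"
      using conjugate_fixes_at_infinity[OF \<Gamma>(1) gG hG _ z(2,3)] z(1) pq by blast
    ultimately show "\<exists>y\<in>{x. \<exists>g\<in>H. loxodromic g \<and> fixes_at_infinity g x}. dist y x < \<epsilon>"
      using f close by blast
  qed
qed

section \<open>Geodesic rays and conical sequences\<close>

text \<open>
  The conical conditions quantify over all rays ending at \<open>x\<close>, so they give information only because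
  such a ray exists.
\<close>

lemma radial_geodesic_ray:
  fixes x :: "real ^ 'n"
  assumes x: "norm x = 1"
  shows "geodesic_ray_to ((\<lambda>t. tanh (t / 2) *\<^sub>R x) ` {0..}) x"
  unfolding geodesic_ray_to_def
proof (rule exI[of _ "\<lambda>t. tanh (t / 2) *\<^sub>R x"], intro conjI allI impI refl)
  let ?c = "\<lambda>t::real. tanh (t / 2) *\<^sub>R x"
  show "?c ` {0..} \<subseteq> hyperbolic_space"
    using x tanh_real_bounds by (auto simp: abs_less_iff)
  show "(?c \<longlongrightarrow> x) at_top"
  proof -
    have "filterlim (\<lambda>t::real. t / 2) at_top at_top"
      unfolding filterlim_at_top
    proof
      fix Z :: real
      show "\<forall>\<^sub>F t in at_top. Z \<le> t / 2"
        using eventually_ge_at_top[of "2 * Z"] by (rule eventually_mono) simp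
    qed
    then have "((\<lambda>t. tanh (t / 2)) \<longlongrightarrow> (1::real)) at_top"
      by (rule filterlim_compose[OF tanh_real_at_top])
    then have "(?c \<longlongrightarrow> 1 *\<^sub>R x) at_top"
      by (intro tendsto_intros)
    then show ?thesis by simp
  qed
  fix s t :: real
  have one_minus: "1 - (norm (?c u))\<^sup>2 = 1 / (cosh (u / 2))\<^sup>2" for u
  proof -
    have "(norm (?c u))\<^sup>2 = (sinh (u / 2))\<^sup>2 / (cosh (u / 2))\<^sup>2"
      using x by (simp add: tanh_def power_divide)
    also have "\<dots> = ((cosh (u / 2))\<^sup>2 - 1) / (cosh (u / 2))\<^sup>2"
      by (simp add: cosh_square_eq)
    also have "\<dots> = 1 - 1 / (cosh (u / 2))\<^sup>2"
      by (simp add: diff_divide_distrib)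
    finally show ?thesis
      by simp
  qed
  have tanh_diff: "tanh a - tanh b = sinh (a - b) / (cosh a * cosh b)" for a b :: real
    by (simp add: tanh_def sinh_diff diff_frac_eq mult.commute)
  have "tanh (s / 2) - tanh (t / 2) = sinh ((s - t) / 2) / (cosh (s / 2) * cosh (t / 2))"
    unfolding tanh_diff diff_divide_distrib ..
  moreover have "?c s - ?c t = (tanh (s / 2) - tanh (t / 2)) *\<^sub>R x"
    by (simp add: scaleR_left_diff_distrib)
  ultimately have "(norm (?c s - ?c t))\<^sup>2 = (sinh ((s - t) / 2))\<^sup>2 / ((cosh (s / 2))\<^sup>2 * (cosh (t / 2))\<^sup>2)"
    using x by (simp add: power_divide power_mult_distrib power2_abs)
  then have "sinh_sq_half (?c s) (?c t) = (sinh ((s - t) / 2))\<^sup>2"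
    unfolding sinh_sq_half_def one_minus by simp
  moreover have "cosh (s - t) = 1 + 2 * (sinh ((s - t) / 2))\<^sup>2"
  proof -
    have half: "s - t = 2 * ((s - t) / 2)"
      unfolding mult_2 field_sum_of_halves ..
    have "cosh (2 * ((s - t) / 2)) = 1 + 2 * (sinh ((s - t) / 2))\<^sup>2"
      unfolding cosh_double cosh_square_eq by linarith
    then show ?thesis
      unfolding half[symmetric] .
  qed
  ultimately have "hdist (?c s) (?c t) = arcosh (cosh (s - t))"
    by (simp add: hdist_eq)
  also have "\<dots> = \<bar>s - t\<bar>"
    using arcosh_cosh_real[of "\<bar>s - t\<bar>"] by (simp add: cosh_real_abs)
  finally show "hdist (?c s) (?c t) = \<bar>s - t\<bar>" .
qed

text \<open>
  Translates of a fixed compact set become small in the Euclidean metric as they approach the sphere.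
\<close>

lemma ball_isometry_shrinks_bounded_sets:
  assumes g: "ball_isometry g" and z: "norm z \<le> \<rho>" and \<rho>: "\<rho> < 1"
  shows "norm (g z - g 0) \<le> (1 - (norm (g 0))\<^sup>2) / (1 - \<rho>)"
proof -
  obtain b where b: "norm b < 1" "g b = 0" "norm b = norm (g 0)"
    using ball_isometry_obtain_zero[OF g] by blast
  have z1: "norm z < 1" using z \<rho> by simp
  have "norm b * norm z \<le> \<rho>"
    using z b(1) mult_right_mono[of "norm b" 1 "norm z"] by simp
  then have "(1 - \<rho>)\<^sup>2 \<le> (1 - norm b * norm z)\<^sup>2"
    using \<rho> by (intro power_mono) auto
  then have D: "(1 - \<rho>)\<^sup>2 \<le> conformal_denom b z"
    using conformal_denom_ge[of b z] by linarith
  have "(norm (g z - g 0))\<^sup>2 = (norm z)\<^sup>2 * (1 - (norm b)\<^sup>2)\<^sup>2 / conformal_denom b z"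
    using ball_isometry_norm_diff[OF g b(1,2) z1, of 0] by simp
  also have "\<dots> \<le> 1 * (1 - (norm b)\<^sup>2)\<^sup>2 / (1 - \<rho>)\<^sup>2"
    using D \<rho> z1 by (intro frac_le mult_right_mono) (auto intro: power_le_one)
  finally have "(norm (g z - g 0))\<^sup>2 \<le> ((1 - (norm (g 0))\<^sup>2) / (1 - \<rho>))\<^sup>2"
    by (simp add: power_divide b(3))
  moreover have "(1 - (norm (g 0))\<^sup>2) / (1 - \<rho>) \<ge> 0"
    using \<rho> b one_minus_norm_sq_pos[OF b(1)] by simp
  ultimately show ?thesis by (rule power2_le_imp_le)
qed

text \<open>
  An initial segment of the ray has bounded hyperbolic length and stays away from the sphere, so the
  points of the ray near the sphere have large parameter.
\<close>

lemma geodesic_ray_tends_to_endpoint: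
  assumes r: "geodesic_ray_to r x" and \<epsilon>: "\<epsilon> > 0"
  obtains \<sigma> where "\<sigma> < 1" "\<And>y. y \<in> r \<Longrightarrow> norm y > \<sigma> \<Longrightarrow> norm (y - x) < \<epsilon>"
proof -
  obtain c where c: "r = c ` {0..}" "r \<subseteq> hyperbolic_space"
    "\<And>s t. s \<ge> 0 \<Longrightarrow> t \<ge> 0 \<Longrightarrow> hdist (c s) (c t) = \<bar>s - t\<bar>" "(c \<longlongrightarrow> x) at_top"
    using r by (auto simp: geodesic_ray_to_def)
  obtain T where T: "\<And>t. t \<ge> T \<Longrightarrow> norm (c t - x) < \<epsilon>"
    using tendstoD[OF c(4) \<epsilon>] by (auto simp: eventually_at_top_linorder dist_norm)
  have cn: "norm (c t) < 1" if "t \<ge> 0" for t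
    using c(1,2) that by auto
  obtain \<sigma> where \<sigma>: "\<sigma> < 1" "\<And>a y :: real ^ 'a. norm a \<le> norm (c 0) \<Longrightarrow> norm y < 1 \<Longrightarrow>
      sinh_sq_half y a \<le> cosh T \<Longrightarrow> norm y \<le> \<sigma>"
    using sinh_sq_half_bounded_imp_norm_bounded[OF cn[OF order_refl]] by blast
  have "norm (y - x) < \<epsilon>" if y: "y \<in> r" "norm y > \<sigma>" for y
  proof -
    obtain t where t: "t \<ge> 0" "y = c t" using y c(1) by auto
    have "t \<ge> T"
    proof (rule ccontr)
      assume "\<not> t \<ge> T"
      have "1 + 2 * sinh_sq_half (c t) (c 0) = cosh t"
        using cosh_hdist[OF cn cn, of t 0] c(3)[of t 0] t by simp
      also have "\<dots> \<le> cosh T"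
        using t \<open>\<not> t \<ge> T\<close> by (simp add: cosh_real_nonneg_le_iff)
      finally have "sinh_sq_half (c t) (c 0) \<le> cosh T"
        using sinh_sq_half_nonneg[OF cn cn, of t 0] t by simp
      then show False
        using \<sigma>(2)[of "c 0" "c t"] cn t y by simp
    qed
    then show ?thesis using T t by simp
  qed
  then show thesis by (rule that[OF \<sigma>(1)])
qed

text \<open>
  The orbit of the origin leaves every smaller ball, since distinct elements of a discrete group can
  bring it back only finitely often. The translates of \<open>M\<close> then shrink, and the points where they
  meet the ray come close both to \<open>x\<close> and to the orbit.
\<close>

proposition conical_sequence_limit:
  fixes \<Gamma> :: "(real ^ 'n \<Rightarrow> real ^ 'n) set"
  assumes \<Gamma>: "kleinian_group \<Gamma>"
    and M: "compact M" "M \<subseteq> hyperbolic_space"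
    and \<psi>: "inj (\<psi> :: nat \<Rightarrow> _)" "range \<psi> \<subseteq> \<Gamma>" "\<And>k. \<psi> k ` M \<inter> r \<noteq> {}"
    and r: "geodesic_ray_to r x" and \<epsilon>: "\<epsilon> > 0"
  shows "\<exists>k. norm (\<psi> k 0 - x) < \<epsilon>"
proof -
  obtain \<rho> where \<rho>: "0 \<le> \<rho>" "\<rho> < 1" "\<And>z. z \<in> M \<Longrightarrow> norm z \<le> \<rho>"
    using compact_hyperbolic_norm_bound[OF M] by blast
  obtain \<sigma> where \<sigma>: "\<sigma> < 1" "\<And>y. y \<in> r \<Longrightarrow> norm y > \<sigma> \<Longrightarrow> norm (y - x) < \<epsilon> / 2"
    using geodesic_ray_tends_to_endpoint[OF r, of "\<epsilon> / 2"] \<epsilon> by auto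
  \<comment> \<open>The second bound keeps points within \<open>\<eta>\<close> of \<open>\<psi>\<^sub>k 0\<close> outside \<open>cball 0 \<sigma>\<close>.\<close>
  define \<eta> where "\<eta> = min (\<epsilon> / 2) ((1 - \<sigma>) / 2)"
  have \<eta>: "\<eta> > 0" "\<eta> \<le> \<epsilon> / 2" "\<eta> \<le> (1 - \<sigma>) / 2"
    using \<epsilon> \<sigma>(1) by (auto simp: \<eta>_def min_def)
  \<comment> \<open>If \<open>\<bar>\<psi>\<^sub>k 0\<bar> > \<tau>\<close>, then the bound \<open>(1 - \<bar>\<psi>\<^sub>k 0\<bar>\<^sup>2) / (1 - \<rho>)\<close> on the size of the
    translate of \<open>M\<close> is less than \<open>\<eta>\<close>.\<close>
  define \<tau> where "\<tau> = max ((1 + \<sigma>) / 2) (max 0 (1 - \<eta> * (1 - \<rho>) / 2))"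
  have \<tau>: "\<tau> < 1" "0 \<le> \<tau>" "\<tau> \<ge> (1 + \<sigma>) / 2" "\<tau> \<ge> 1 - \<eta> * (1 - \<rho>) / 2"
    using \<eta>(1) \<rho>(2) \<sigma>(1) by (auto simp: \<tau>_def)
  have "infinite (range \<psi>)"
    using \<psi>(1) by (simp add: finite_image_iff)
  then have "\<not> range \<psi> \<subseteq> {g \<in> \<Gamma>. \<exists>b. norm b \<le> \<tau> \<and> norm (g b) \<le> \<tau>}"
    using kleinian_group_properly_discontinuous[OF \<Gamma> \<tau>(1)] finite_subset by blast
  then obtain k where "\<not> norm (\<psi> k 0) \<le> \<tau>"
    using \<psi>(2) \<tau>(2) by (auto simp: subset_iff image_iff) (metis norm_zero)
  then have k: "norm (\<psi> k 0) > \<tau>" by simp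
  have iso: "ball_isometry (\<psi> k)"
    using \<psi>(2) by (intro kleinian_group_ball_isometry[OF \<Gamma>]) auto
  obtain z where z: "z \<in> M" "\<psi> k z \<in> r" using \<psi>(3)[of k] by auto
  have "1 - (norm (\<psi> k 0))\<^sup>2 \<le> 2 * (1 - norm (\<psi> k 0))"
    using sum_power2_ge_zero[of "1 - norm (\<psi> k 0)" 0] by (simp add: power2_eq_square algebra_simps)
  also have "\<dots> < \<eta> * (1 - \<rho>)"
    using k \<tau>(4) by simp
  finally have "(1 - (norm (\<psi> k 0))\<^sup>2) / (1 - \<rho>) < \<eta>"
    using \<rho>(2) by (simp add: divide_less_eq)
  then have near: "norm (\<psi> k z - \<psi> k 0) < \<eta>"
    using ball_isometry_shrinks_bounded_sets[OF iso \<rho>(3)[OF z(1)] \<rho>(2)] by linarith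
  have "norm (\<psi> k z) > \<sigma>"
    using near k \<tau>(3) \<eta>(3) norm_triangle_ineq2[of "\<psi> k 0" "\<psi> k z"] norm_minus_commute[of "\<psi> k 0" "\<psi> k z"]
    by argo
  then have "norm (\<psi> k z - x) < \<epsilon> / 2" by (rule \<sigma>(2)[OF z(2)])
  then have "norm (\<psi> k 0 - x) < \<epsilon>"
    using near \<eta>(2) norm_triangle_ineq4[of "\<psi> k z - x" "\<psi> k z - \<psi> k 0"] by simp
  then show ?thesis by blast
qed

section \<open>Conical limit points of the intersection\<close>

lemma limit_set_subset_sphere: "limit_set G \<subseteq> sphere_at_infinity"
  unfolding limit_set_def by (intro closure_minimal) (auto simp: fixes_at_infinity_def)

theorem proposition1:
  fixes \<Gamma> \<Phi> \<Theta> :: "(real ^ 'n \<Rightarrow> real ^ 'n) set"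
  assumes "CARD('n) \<ge> 2"
    and "kleinian_group \<Gamma>" and "purely_loxodromic \<Gamma>" and "non_elementary \<Gamma>"
    and "subgroup \<Phi> (hyp_group \<Gamma>)" and "\<Phi> \<noteq> {\<one>\<^bsub>hyp_group \<Gamma>\<^esub>}"
    and "subgroup \<Theta> (hyp_group \<Gamma>)" and "\<Theta> \<noteq> {\<one>\<^bsub>hyp_group \<Gamma>\<^esub>}"
  shows "conical_limit_set \<Phi> \<inter> uniform_conical_limit_set \<Theta> \<subseteq> conical_limit_set (\<Phi> \<inter> \<Theta>)"
proof
  fix x assume x: "x \<in> conical_limit_set \<Phi> \<inter> uniform_conical_limit_set \<Theta>"
  note \<Gamma> = \<open>kleinian_group \<Gamma>\<close>
  have sub: "subgroup \<Phi> ball_group" "subgroup \<Theta> ball_group"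
    using group.incl_subgroup[OF group_BijGroup kleinian_group_subgroup[OF \<Gamma>]] assms by auto
  have in\<Gamma>: "\<Phi> \<subseteq> \<Gamma>" "\<Theta> \<subseteq> \<Gamma>"
    using subgroup.subset[OF assms(5)] subgroup.subset[OF assms(7)] by auto
  have subI: "subgroup (\<Phi> \<inter> \<Theta>) ball_group"
    using group.subgroups_Inter_pair[OF group_BijGroup sub] .
  have seq: "\<exists>M (\<psi> :: nat \<Rightarrow> real ^ 'n \<Rightarrow> real ^ 'n). compact M \<and> M \<subseteq> hyperbolic_space \<and> inj \<psi> \<and>
      range \<psi> \<subseteq> \<Phi> \<inter> \<Theta> \<and> (\<forall>k. \<psi> k ` M \<inter> r \<noteq> {})" if r: "geodesic_ray_to r x" for r
  proof -
    obtain K \<phi> where "compact K" "K \<subseteq> hyperbolic_space" "inj (\<phi> :: nat \<Rightarrow> _)" "range \<phi> \<subseteq> \<Phi>"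
      "\<And>k. \<phi> k ` K \<inter> r \<noteq> {}"
      using x r unfolding conical_limit_set_def by blast
    moreover obtain L \<theta> where "compact L" "L \<subseteq> hyperbolic_space" "range (\<theta> :: nat \<Rightarrow> _) \<subseteq> \<Theta>"
      "r \<subseteq> (\<Union>j. \<theta> j ` L)"
      using x r unfolding uniform_conical_limit_set_def by blast
    ultimately show ?thesis
      by (intro conical_sequence_inter[OF \<Gamma> sub(1) in\<Gamma>(1) sub(2) in\<Gamma>(2)])
  qed
  have xn: "norm x = 1"
    using x limit_set_subset_sphere[of \<Phi>] by (auto simp: conical_limit_set_def)
  have "x \<in> limit_set (\<Phi> \<inter> \<Theta>)"
  proof -
    note ray = radial_geodesic_ray[OF xn]
    obtain M and \<psi> :: "nat \<Rightarrow> real ^ 'n \<Rightarrow> real ^ 'n" where M: "compact M" "M \<subseteq> hyperbolic_space"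
      and \<psi>: "inj \<psi>" "range \<psi> \<subseteq> \<Phi> \<inter> \<Theta>"
      "\<And>k. \<psi> k ` M \<inter> (\<lambda>t. tanh (t / 2) *\<^sub>R x) ` {0..} \<noteq> {}"
      using seq[OF ray] by blast
    have \<psi>\<Gamma>: "range \<psi> \<subseteq> \<Gamma>" using \<psi>(2) in\<Gamma> by blast
    \<comment> \<open>Being pairwise distinct, the \<open>\<psi>\<^sub>k\<close> include a nontrivial element, whose fixed points can be moved
      towards \<open>x\<close>.\<close>
    obtain k where "\<psi> k \<noteq> \<one>\<^bsub>ball_group\<^esub>"
      using injD[OF \<psi>(1), of 0 1] by (metis zero_neq_one)
    moreover have "\<exists>g\<in>\<Phi> \<inter> \<Theta>. norm (g 0 - x) < \<epsilon>" if "\<epsilon> > 0" for \<epsilon>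
      using conical_sequence_limit[OF \<Gamma> M \<psi>(1) \<psi>\<Gamma> \<psi>(3) ray that] \<psi>(2) by blast
    ultimately show ?thesis
      using \<psi>(2) in\<Gamma> xn
      by (intro orbit_accumulation_in_limit_set[OF \<Gamma> \<open>purely_loxodromic \<Gamma>\<close> subI, of "\<psi> k"]) auto
  qed
  then show "x \<in> conical_limit_set (\<Phi> \<inter> \<Theta>)"
    using seq by (simp add: conical_limit_set_def)
qed

end
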